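(* Let $X$ be a Hausdorff space admitting a fixed-point free involution $\tau$, and let $q:X\to X/\tau$ be the quotient map. If $n$ is an integer with $1\leq n\leq \mathrm{secat}(q)-1$, then the triple $\left((X,\tau);\mathbb{R}^n\right)$ satisfies the Borsuk-Ulam property (BUP). In particular, the index of $\tau$ on $X$ is at least $\mathrm{secat}(q)-1$.
   Context: The triple $\left((X,\tau);Y\right)$ ($X,Y$ Hausdorff, $\tau$ a continuous fixed-point free involution on $X$) satisfies the Borsuk-Ulam property (BUP) if for every continuous map $f:X\to Y$ there exists $x\in X$ with $f(\tau(x))=f(x)$. The index of $\tau$ on $X$ is $\mathrm{ind}_{\mathbb{Z}_2}(X)=\min\{n\in\{0,1,2,\ldots\}: \text{there is a continuous } \mathbb{Z}_2\text{-equivariant map } X\to S^n\}$, where $\mathbb{Z}_2$ acts on $X$ by $\tau$ and on $S^n$ by the antipodal map; the index is $\infty$ if there is no such $n$. The sectional category $\mathrm{secat}(q)$ of the 2-sheeted covering $q$ is the minimal cardinality of an open cover of $X/\tau$ such that over each member $U$ there is a continuous local section $s:U\to X$ (i.e. $q\circ s$ is the inclusion $U\hookrightarrow X/\tau$); $\mathrm{secat}(q)=\infty$ if no finite such cover exists. By convention $\infty-1=\infty$. *)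

theory Defs
  imports "HOL-Analysis.Analysis" "HOL-Library.Extended_Nat"
begin

definition free_involution :: "'a topology \<Rightarrow> ('a \<Rightarrow> 'a) \<Rightarrow> bool" where
  "free_involution X \<tau> \<longleftrightarrow>
     continuous_map X X \<tau> \<and>
     (\<forall>x\<in>topspace X. \<tau> (\<tau> x) = x \<and> \<tau> x \<noteq> x)"

text \<open>Points of the orbit space \<open>X/\<tau>\<close> are the orbits \<open>{x, \<tau> x}\<close>, and it carries the
  final topology with respect to the canonical projection.\<close>

definition orbit_proj :: "('a \<Rightarrow> 'a) \<Rightarrow> 'a \<Rightarrow> 'a set" where
  "orbit_proj \<tau> x = {x, \<tau> x}"

definition orbit_space :: "'a topology \<Rightarrow> ('a \<Rightarrow> 'a) \<Rightarrow> 'a set topology" where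
  "orbit_space X \<tau> = topology (\<lambda>U.
     U \<subseteq> orbit_proj \<tau> ` topspace X \<and> openin X {x \<in> topspace X. orbit_proj \<tau> x \<in> U})"

lemma openin_orbit_space:
  "openin (orbit_space X \<tau>) U \<longleftrightarrow>
     U \<subseteq> orbit_proj \<tau> ` topspace X \<and> openin X {x \<in> topspace X. orbit_proj \<tau> x \<in> U}"
proof -
  let ?P = "\<lambda>U. U \<subseteq> orbit_proj \<tau> ` topspace X \<and> openin X {x \<in> topspace X. orbit_proj \<tau> x \<in> U}"
  have "istopology ?P"
    unfolding istopology_def
  proof (intro conjI allI impI)
    fix S T assume S: "?P S" and T: "?P T"
    show "S \<inter> T \<subseteq> orbit_proj \<tau> ` topspace X" using S by blast
    have "{x \<in> topspace X. orbit_proj \<tau> x \<in> S \<inter> T} =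
      {x \<in> topspace X. orbit_proj \<tau> x \<in> S} \<inter> {x \<in> topspace X. orbit_proj \<tau> x \<in> T}" by blast
    then show "openin X {x \<in> topspace X. orbit_proj \<tau> x \<in> S \<inter> T}" using S T by auto
  next
    fix \<K> assume K: "\<forall>K\<in>\<K>. ?P K"
    show "\<Union>\<K> \<subseteq> orbit_proj \<tau> ` topspace X" using K by blast
    have "{x \<in> topspace X. orbit_proj \<tau> x \<in> \<Union>\<K>} =
      \<Union>((\<lambda>K. {x \<in> topspace X. orbit_proj \<tau> x \<in> K}) ` \<K>)" by blast
    then show "openin X {x \<in> topspace X. orbit_proj \<tau> x \<in> \<Union>\<K>}" using K by auto
  qed
  then show ?thesis
    by (simp add: orbit_space_def topology_inverse')
qed

lemma topspace_orbit_space: "topspace (orbit_space X \<tau>) = orbit_proj \<tau> ` topspace X"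
proof -
  have "{x \<in> topspace X. orbit_proj \<tau> x \<in> orbit_proj \<tau> ` topspace X} = topspace X" by blast
  then have "openin (orbit_space X \<tau>) (orbit_proj \<tau> ` topspace X)"
    by (simp add: openin_orbit_space)
  then show ?thesis
    by (meson openin_orbit_space openin_subset openin_topspace subset_antisym)
qed

lemma quotient_map_orbit_proj: "quotient_map X (orbit_space X \<tau>) (orbit_proj \<tau>)"
  by (auto simp: quotient_map_def topspace_orbit_space openin_orbit_space)

lemma orbit_proj_eq_iff:
  assumes "free_involution X \<tau>" "x \<in> topspace X" "y \<in> topspace X"
  shows "orbit_proj \<tau> x = orbit_proj \<tau> y \<longleftrightarrow> y = x \<or> y = \<tau> x"
  using assms by (auto simp: orbit_proj_def free_involution_def doubleton_eq_iff)

definition borsuk_ulam_property ::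
  "'a topology \<Rightarrow> ('a \<Rightarrow> 'a) \<Rightarrow> 'b topology \<Rightarrow> bool" where
  "borsuk_ulam_property X \<tau> Y \<longleftrightarrow>
     (\<forall>f. continuous_map X Y f \<longrightarrow> (\<exists>x\<in>topspace X. f (\<tau> x) = f x))"

text \<open>In \<^typ>\<open>enat\<close> the infimum of a nonempty set is its minimum and \<open>Inf {} = \<infinity>\<close>, as
  required by the conventions for the index and the sectional category.\<close>

definition index_Z2 :: "'a topology \<Rightarrow> ('a \<Rightarrow> 'a) \<Rightarrow> enat" where
  "index_Z2 X \<tau> = Inf {enat n | n.
     \<exists>f. continuous_map X (nsphere n) f \<and> (\<forall>x\<in>topspace X. f (\<tau> x) = (\<lambda>i. - f x i))}"

definition secat :: "'a topology \<Rightarrow> 'b topology \<Rightarrow> ('a \<Rightarrow> 'b) \<Rightarrow> enat" where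
  "secat E B p = Inf {enat (card \<U>) | \<U>.
     finite \<U> \<and> (\<forall>U\<in>\<U>. openin B U) \<and> \<Union>\<U> = topspace B \<and>
     (\<forall>U\<in>\<U>. \<exists>s. continuous_map (subtopology B U) E s \<and> (\<forall>b\<in>U. p (s b) = b))}"

end

theory Submission
  imports Defs
begin

text \<open>
  The idea is that the coordinates of a map without coincidences already write down a trivialising
  cover of the orbit space. Suppose that \<open>g\<^sub>0, \<dots>, g\<^sub>k\<^sub>-\<^sub>1\<close> are continuous real functions on \<open>X\<close>, odd
  with respect to \<open>\<tau>\<close> and without a common zero. The open set on which \<open>g\<^sub>i\<close> is positive meets each
  orbit at most once, because \<open>g\<^sub>i\<close> changes sign along an orbit; picking the point of the orbit at
  which \<open>g\<^sub>i\<close> is positive is therefore a section over the image of that set, and it is continuous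
  because the orbit projection is open. Every orbit contains a point at which some \<open>g\<^sub>i\<close> is positive,
  so these \<open>k\<close> images cover the orbit space and \<open>secat \<le> k\<close> (lemma \<open>secat_le_odd_functions\<close>).

  If \<open>f : X \<rightarrow> \<real>\<^sup>n\<close> never identifies the two points of an orbit, the \<open>n\<close> coordinates of
  \<open>f x - f (\<tau> x)\<close> are such functions, hence \<open>secat \<le> n\<close>. An equivariant map to \<open>S\<^sup>n\<close> has \<open>n + 1\<close> such
  coordinates, hence \<open>secat \<le> n + 1\<close>. The theorem restates these two bounds.
\<close>

text \<open>The saturation of an open set \<open>W\<close> is \<open>W \<union> \<tau>\<^sup>-\<^sup>1 W\<close>, a union of two open sets.\<close>

lemma open_map_orbit_proj:
  assumes "free_involution X \<tau>"
  shows "open_map X (orbit_space X \<tau>) (orbit_proj \<tau>)"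
  unfolding open_map_def
proof (intro allI impI)
  fix W assume W: "openin X W"
  then have WX: "W \<subseteq> topspace X" by (rule openin_subset)
  have "{x \<in> topspace X. orbit_proj \<tau> x \<in> orbit_proj \<tau> ` W} = W \<union> {x \<in> topspace X. \<tau> x \<in> W}"
  proof -
    have "orbit_proj \<tau> x \<in> orbit_proj \<tau> ` W \<longleftrightarrow> x \<in> W \<or> \<tau> x \<in> W" if x: "x \<in> topspace X" for x
      using orbit_proj_eq_iff[OF assms x] WX by (auto simp: image_iff subset_iff)
    then show ?thesis using WX by blast
  qed
  moreover have "openin X {x \<in> topspace X. \<tau> x \<in> W}"
    using assms W by (auto simp: free_involution_def intro: openin_continuous_map_preimage)
  ultimately show "openin (orbit_space X \<tau>) (orbit_proj \<tau> ` W)"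
    using W WX by (auto simp: openin_orbit_space)
qed

text \<open>On an open set that meets each orbit at most once the orbit projection is injective and open,
  so its inverse is continuous.\<close>

lemma section_over_asymmetric_open:
  assumes inv: "free_involution X \<tau>" and A: "openin X A"
    and asym: "\<And>x. x \<in> A \<Longrightarrow> \<tau> x \<notin> A"
  shows "\<exists>s. continuous_map (subtopology (orbit_space X \<tau>) (orbit_proj \<tau> ` A)) X s \<and>
             (\<forall>b\<in>orbit_proj \<tau> ` A. orbit_proj \<tau> (s b) = b)"
proof -
  let ?q = "orbit_proj \<tau>"
  define s where "s = inv_into A ?q"
  have AX: "A \<subseteq> topspace X" using A by (rule openin_subset)
  have "inj_on ?q A"
    using orbit_proj_eq_iff[OF inv] AX asym by (fastforce simp: inj_on_def)
  then have sq: "s (?q x) = x" if "x \<in> A" for x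
    using that by (simp add: s_def)
  have "continuous_map (subtopology (orbit_space X \<tau>) (?q ` A)) X s"
    unfolding continuous_map
  proof (intro conjI allI impI)
    show "s ` topspace (subtopology (orbit_space X \<tau>) (?q ` A)) \<subseteq> topspace X"
      using sq AX by auto
  next
    fix V assume V: "openin X V"
    have "{b \<in> topspace (subtopology (orbit_space X \<tau>) (?q ` A)). s b \<in> V} = ?q ` (A \<inter> V)"
      using sq AX by (auto simp: topspace_orbit_space)
    moreover have "openin (orbit_space X \<tau>) (?q ` (A \<inter> V))"
      using open_map_orbit_proj[OF inv] A V by (simp add: open_map_def openin_Int)
    ultimately show "openin (subtopology (orbit_space X \<tau>) (?q ` A))
        {b \<in> topspace (subtopology (orbit_space X \<tau>) (?q ` A)). s b \<in> V}"
      by (simp add: openin_subset_topspace_eq openin_subtopology) blast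
  qed
  then show ?thesis using sq by auto
qed

text \<open>Each function contributes the image of its positivity set to the cover. Two functions may
  contribute the same image, so the cover has at most, and not exactly, \<open>k\<close> members.\<close>

lemma secat_le_odd_functions:
  fixes g :: "nat \<Rightarrow> 'a \<Rightarrow> real"
  assumes inv: "free_involution X \<tau>"
    and cont: "\<And>i. i < k \<Longrightarrow> continuous_map X euclideanreal (g i)"
    and odd: "\<And>i x. i < k \<Longrightarrow> x \<in> topspace X \<Longrightarrow> g i (\<tau> x) = - g i x"
    and nz: "\<And>x. x \<in> topspace X \<Longrightarrow> \<exists>i<k. g i x \<noteq> 0"
  shows "secat X (orbit_space X \<tau>) (orbit_proj \<tau>) \<le> enat k"
proof -
  let ?q = "orbit_proj \<tau>"
  define A where "A i = {x \<in> topspace X. 0 < g i x}" for i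
  let ?\<U> = "(\<lambda>i. ?q ` A i) ` {..<k}"
  have A: "openin X (A i)" if "i < k" for i
    using openin_continuous_map_preimage[OF cont[OF that], of "{0<..}"] by (simp add: A_def)
  have asym: "\<tau> x \<notin> A i" if "i < k" "x \<in> A i" for i x
    using odd[of i x] that by (auto simp: A_def)
  have opens: "\<forall>U\<in>?\<U>. openin (orbit_space X \<tau>) U"
    using open_map_orbit_proj[OF inv] A by (auto simp: open_map_def)
  have "?q x \<in> \<Union>?\<U>" if x: "x \<in> topspace X" for x
  proof -
    obtain i where i: "i < k" "g i x \<noteq> 0" using nz[OF x] by blast
    have \<tau>x: "\<tau> x \<in> topspace X" "?q (\<tau> x) = ?q x"
      using inv x by (auto simp: free_involution_def continuous_map_def orbit_proj_def)
    have "x \<in> A i \<or> \<tau> x \<in> A i"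
      using i x \<tau>x odd[of i x] by (auto simp: A_def)
    then have "?q x \<in> ?q ` A i"
      using \<tau>x(2) by (metis imageI)
    then show ?thesis using i(1) by blast
  qed
  then have cover: "\<Union>?\<U> = topspace (orbit_space X \<tau>)"
    by (auto simp: topspace_orbit_space A_def)
  have sections: "\<forall>U\<in>?\<U>. \<exists>s. continuous_map (subtopology (orbit_space X \<tau>) U) X s \<and>
      (\<forall>b\<in>U. ?q (s b) = b)"
    using section_over_asymmetric_open[OF inv A asym] by blast
  have "secat X (orbit_space X \<tau>) ?q \<le> enat (card ?\<U>)"
    unfolding secat_def using opens cover sections
    by (intro Inf_lower CollectI exI[of _ ?\<U>] conjI refl) auto
  also have "\<dots> \<le> enat k"
    using card_image_le[of "{..<k}" "\<lambda>i. ?q ` A i"] by simp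
  finally show ?thesis .
qed

lemma secat_le_if_not_borsuk_ulam:
  assumes inv: "free_involution X \<tau>"
    and nbu: "\<not> borsuk_ulam_property X \<tau> (Euclidean_space n)"
  shows "secat X (orbit_space X \<tau>) (orbit_proj \<tau>) \<le> enat n"
proof -
  obtain f where f: "continuous_map X (Euclidean_space n) f"
    and neq: "\<And>x. x \<in> topspace X \<Longrightarrow> f (\<tau> x) \<noteq> f x"
    using nbu by (auto simp: borsuk_ulam_property_def)
  have \<tau>: "continuous_map X X \<tau>" "\<And>x. x \<in> topspace X \<Longrightarrow> \<tau> (\<tau> x) = x"
    using inv by (auto simp: free_involution_def)
  have f': "continuous_map X (powertop_real UNIV) f"
    and supp: "\<And>x i. x \<in> topspace X \<Longrightarrow> n \<le> i \<Longrightarrow> f x i = 0"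
    using f by (auto simp: Euclidean_space_def continuous_map_in_subtopology image_subset_iff)
  have fi: "continuous_map X euclideanreal (\<lambda>x. f x i)" for i
    using f' by (simp add: continuous_map_componentwise_UNIV)
  show ?thesis
  proof (rule secat_le_odd_functions[OF inv, of _ "\<lambda>i x. f x i - f (\<tau> x) i"])
    fix i
    show "continuous_map X euclideanreal (\<lambda>x. f x i - f (\<tau> x) i)"
      using continuous_map_compose[OF \<tau>(1) fi[of i]]
      by (intro continuous_map_diff fi) (simp add: o_def)
  next
    fix x assume x: "x \<in> topspace X"
    then have "\<tau> x \<in> topspace X" using \<tau>(1) by (auto simp: continuous_map_def)
    then show "\<exists>i<n. f x i - f (\<tau> x) i \<noteq> 0"
      using neq[OF x] supp x by (metis eq_iff_diff_eq_0 ext not_le_imp_less)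
  qed (simp add: \<tau>)
qed

lemma secat_le_if_equivariant_map_to_sphere:
  assumes inv: "free_involution X \<tau>"
    and f: "continuous_map X (nsphere n) f"
    and equiv: "\<And>x. x \<in> topspace X \<Longrightarrow> f (\<tau> x) = (\<lambda>i. - f x i)"
  shows "secat X (orbit_space X \<tau>) (orbit_proj \<tau>) \<le> enat (Suc n)"
proof (rule secat_le_odd_functions[OF inv, of _ "\<lambda>i x. f x i"])
  have f': "continuous_map X (powertop_real UNIV) f"
    and norm1: "\<And>x. x \<in> topspace X \<Longrightarrow> (\<Sum>i\<le>n. (f x i)\<^sup>2) = 1"
    using f by (auto simp: nsphere continuous_map_in_subtopology image_subset_iff)
  show "continuous_map X euclideanreal (\<lambda>x. f x i)" for i
    using f' by (simp add: continuous_map_componentwise_UNIV)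
  fix x assume "x \<in> topspace X"
  then show "\<exists>i<Suc n. f x i \<noteq> 0"
    using norm1[of x] by (force simp: less_Suc_eq_le intro: ccontr)
qed (simp add: equiv)

(* Subtraction on enat satisfies \<infinity> - 1 = \<infinity> and 0 - 1 = 0. The truncation only occurs for empty X
   (secat = 0), where it changes nothing: the first part has n \<ge> 1 and the index is never negative. *)
theorem theorem3p30:
  fixes X :: "'a topology" and \<tau> :: "'a \<Rightarrow> 'a"
  assumes "Hausdorff_space X"
    and "free_involution X \<tau>"
  shows "(\<forall>n::nat. 1 \<le> n \<and> enat n \<le> secat X (orbit_space X \<tau>) (orbit_proj \<tau>) - 1 \<longrightarrow>
            borsuk_ulam_property X \<tau> (Euclidean_space n)) \<and>
         secat X (orbit_space X \<tau>) (orbit_proj \<tau>) - 1 \<le> index_Z2 X \<tau>"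
proof (intro conjI allI impI)
  let ?c = "secat X (orbit_space X \<tau>) (orbit_proj \<tau>)"
  fix n :: nat assume n: "1 \<le> n \<and> enat n \<le> ?c - 1"
  show "borsuk_ulam_property X \<tau> (Euclidean_space n)"
  proof (rule ccontr)
    assume "\<not> ?thesis"
    then have "?c \<le> enat n" by (rule secat_le_if_not_borsuk_ulam[OF assms(2)])
    then show False using n by (cases ?c) (auto simp: one_enat_def)
  qed
next
  let ?c = "secat X (orbit_space X \<tau>) (orbit_proj \<tau>)"
  show "?c - 1 \<le> index_Z2 X \<tau>"
    unfolding index_Z2_def
  proof (rule Inf_greatest, clarify)
    fix n f assume "continuous_map X (nsphere n) f" "\<forall>x\<in>topspace X. f (\<tau> x) = (\<lambda>i. - f x i)"
    then have "?c \<le> enat (Suc n)"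
      using secat_le_if_equivariant_map_to_sphere[OF assms(2)] by blast
    then show "?c - 1 \<le> enat n" by (cases ?c) (auto simp: one_enat_def)
  qed
qed

end
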